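(* Suppose $\Sigma$ is a finite set with $2\le|\Sigma|<\infty$. Let $\ell:X\times\Sigma\to\mathbb{R}$ be any loss function and let $r>0$. If $\hat c\in\mathcal{C}_u(X\times\mathcal{P}(\Sigma))$ is pointwise feasible at rate $r$ or uniformly feasible at rate $r$, then $$\hat c_{\mathrm{KL},r}(x,\hat P)\le\hat c(x,\hat P)\qquad\text{for all }x\in X,\ \hat P\in\mathcal{P}(\Sigma).$$
   Context: $X\subseteq\mathbb{R}^m$ is a nonempty set of decisions. $\Sigma$ is a finite set equipped with all subsets as $\sigma$-algebra, and $\mathcal{P}(\Sigma)=\{P\in\mathbb{R}^{|\Sigma|}:\sum_{i\in\Sigma}P(i)=1,\ P(i)\ge0\}$ with the topology induced from $\mathbb{R}^{|\Sigma|}$. The loss $\ell:X\times\Sigma\to\mathbb{R}$ is bounded below, and $c(x,P):=\mathbb{E}_P[\ell(x,\xi)]$. For $P\in\mathcal{P}(\Sigma)$, $\xi_1,\xi_2,\dots$ are i.i.d. samples from $P$, $P_N:=\frac1N\sum_{i=1}^N\delta_{\xi_i}$ is the empirical distribution, and $\mathrm{Prob}$ is the probability under this sampling; $\log 0=-\infty$. A predictor is a function $\hat c:X\times\mathcal{P}(\Sigma)\to\mathbb{R}$. $\mathcal{C}_u(X\times\mathcal{P}(\Sigma))$ is the set of predictors such that $\hat P\mapsto\hat c(x,\hat P)$ is upper semicontinuous for each $x\in X$. A predictor $\hat c$ is uniformly feasible at rate $r$ if $\sup_{P\in\mathcal{P}(\Sigma)}\limsup_{N\to\infty}\frac1N\log\mathrm{Prob}[\exists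 x\in X: c(x,P)>\hat c(x,P_N)]\le -r$; it is pointwise feasible at rate $r$ if $\sup_{P\in\mathcal{P}(\Sigma),\,x\in X}\limsup_{N\to\infty}\frac1N\log\mathrm{Prob}[c(x,P)>\hat c(x,P_N)]\le -r$. KL divergence (convention on the order of arguments): $D_{\mathrm{KL}}(P',P)=\sum_{\xi\in\Sigma}P'(\xi)\log\frac{P'(\xi)}{P(\xi)}$ if $P'\ll P$, with $0\log 0=0$, and $D_{\mathrm{KL}}(P',P)=+\infty$ otherwise. KL-DRO predictor: $\hat c_{\mathrm{KL},r}(x,\hat P):=\sup\{c(x,P): P\in\mathcal{P}(\Sigma),\ D_{\mathrm{KL}}(\hat P,P)\le r\}$. *)

theory Defs
  imports "HOL-Probability.Probability"
begin

text \<open>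
  The finite set \<open>\<Sigma>\<close> is the universe of a finite type \<open>'s\<close>, and a distribution on it is its
  vector of point masses in \<open>real ^ 's\<close>.
\<close>

definition prob_simplex :: "(real ^ 's::finite) set" where
  "prob_simplex = {P. (\<Sum>i\<in>UNIV. P $ i) = 1 \<and> (\<forall>i. 0 \<le> P $ i)}"

definition dist_measure :: "real ^ 's::finite \<Rightarrow> 's measure" where
  "dist_measure P = point_measure UNIV (\<lambda>i. ennreal (P $ i))"

definition expected_cost :: "('x \<Rightarrow> 's \<Rightarrow> real) \<Rightarrow> 'x \<Rightarrow> real ^ 's::finite \<Rightarrow> real" where
  "expected_cost l x P = (LINT \<xi>|dist_measure P. l x \<xi>)"

definition loss_bounded_below :: "'x set \<Rightarrow> ('x \<Rightarrow> 's \<Rightarrow> real) \<Rightarrow> bool" where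
  "loss_bounded_below X l \<longleftrightarrow> (\<exists>b. \<forall>x\<in>X. \<forall>\<xi>. b \<le> l x \<xi>)"

text \<open>
  The i.i.d. samples are the coordinates of the infinite product space; the \<open>k\<close>-th coordinate
  (counting from 0) is the sample \<open>\<xi>\<^sub>k\<^sub>+\<^sub>1\<close>.
\<close>

definition iid_measure :: "real ^ 's::finite \<Rightarrow> (nat \<Rightarrow> 's) measure" where
  "iid_measure P = Pi\<^sub>M UNIV (\<lambda>_. dist_measure P)"

text \<open>The Dirac distribution at \<open>s\<close> is the unit vector \<open>axis s 1\<close>.\<close>

definition empirical :: "nat \<Rightarrow> (nat \<Rightarrow> 's) \<Rightarrow> real ^ 's::finite" where
  "empirical N \<omega> = (1 / real N) *\<^sub>R (\<Sum>k<N. axis (\<omega> k) 1)"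

definition Prob :: "real ^ 's::finite \<Rightarrow> ((nat \<Rightarrow> 's) \<Rightarrow> bool) \<Rightarrow> real" where
  "Prob P E = measure (iid_measure P) {\<omega> \<in> space (iid_measure P). E \<omega>}"

text \<open>Logarithm of a nonnegative real, with \<open>log 0 = -\<infinity>\<close> (the library has \<open>ln 0 = 0\<close>).\<close>

definition elog :: "real \<Rightarrow> ereal" where
  "elog p = (if p = 0 then -\<infinity> else ereal (ln p))"

text \<open>
  Predictors are total functions here; only their values on \<open>X \<times> prob_simplex\<close> enter the notions
  below. The value at the zero vector \<open>empirical 0 \<omega>\<close> does not affect any limes superior.
\<close>

type_synonym ('x, 's) predictor = "'x \<Rightarrow> real ^ 's \<Rightarrow> real"

definition usc_on :: "'a::topological_space set \<Rightarrow> ('a \<Rightarrow> real) \<Rightarrow> bool" where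
  "usc_on S f \<longleftrightarrow> (\<forall>p\<in>S. \<forall>a. f p < a \<longrightarrow> (\<forall>\<^sub>F q in at p within S. f q < a))"

definition usc_predictors :: "'x set \<Rightarrow> ('x, 's::finite) predictor set" where
  "usc_predictors X = {chat. \<forall>x\<in>X. usc_on prob_simplex (chat x)}"

definition uniformly_feasible ::
    "'x set \<Rightarrow> ('x \<Rightarrow> 's \<Rightarrow> real) \<Rightarrow> real \<Rightarrow> ('x, 's::finite) predictor \<Rightarrow> bool" where
  "uniformly_feasible X l r chat \<longleftrightarrow>
     (SUP P\<in>prob_simplex.
        limsup (\<lambda>N. ereal (1 / real N) *
          elog (Prob P (\<lambda>\<omega>. \<exists>x\<in>X. expected_cost l x P > chat x (empirical N \<omega>)))))
     \<le> ereal (- r)"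

definition pointwise_feasible ::
    "'x set \<Rightarrow> ('x \<Rightarrow> 's \<Rightarrow> real) \<Rightarrow> real \<Rightarrow> ('x, 's::finite) predictor \<Rightarrow> bool" where
  "pointwise_feasible X l r chat \<longleftrightarrow>
     (SUP (P, x)\<in>prob_simplex \<times> X.
        limsup (\<lambda>N. ereal (1 / real N) *
          elog (Prob P (\<lambda>\<omega>. expected_cost l x P > chat x (empirical N \<omega>)))))
     \<le> ereal (- r)"

text \<open>
  Under absolute continuity, the terms with \<open>P' $ \<xi> = 0\<close> (in particular those with \<open>P $ \<xi> = 0\<close>)
  vanish, as required by \<open>0 log 0 = 0\<close>. The library's \<open>KL_divergence\<close> has no value \<open>\<infinity>\<close>.
\<close>

definition D_KL :: "real ^ 's::finite \<Rightarrow> real ^ 's \<Rightarrow> ereal" where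
  "D_KL P' P =
     (if absolutely_continuous (dist_measure P) (dist_measure P')
      then ereal (\<Sum>\<xi>\<in>UNIV. P' $ \<xi> * ln (P' $ \<xi> / P $ \<xi>))
      else \<infinity>)"

definition KL_DRO :: "('x \<Rightarrow> 's \<Rightarrow> real) \<Rightarrow> real \<Rightarrow> ('x, 's::finite) predictor" where
  "KL_DRO l r x Phat = Sup {expected_cost l x P |P. P \<in> prob_simplex \<and> D_KL Phat P \<le> ereal r}"

text \<open>
  The remaining facts show that the definitions are meaningful: the measures are probability
  measures, all events used are measurable, and the supremum in \<open>KL_DRO\<close> is that of a nonempty
  set bounded above.
\<close>

lemma expected_cost_eq_sum:
  assumes "P \<in> prob_simplex"
  shows "expected_cost l x P = (\<Sum>\<xi>\<in>UNIV. P $ \<xi> * l x \<xi>)"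
  using assms unfolding expected_cost_def dist_measure_def prob_simplex_def
  by (subst lebesgue_integral_point_measure_finite) auto

lemma prob_space_dist_measure:
  assumes "P \<in> prob_simplex"
  shows "prob_space (dist_measure P)"
  using assms unfolding dist_measure_def prob_simplex_def
  by (intro prob_spaceI) (simp add: space_point_measure emeasure_point_measure_finite sum_ennreal)

lemma prob_space_iid_measure:
  assumes "P \<in> prob_simplex"
  shows "prob_space (iid_measure P)"
  unfolding iid_measure_def by (intro prob_space_PiM prob_space_dist_measure assms)

lemma empirical_in_prob_simplex:
  assumes "0 < N"
  shows "empirical N \<omega> \<in> prob_simplex"
proof -
  have "(\<Sum>i\<in>UNIV. \<Sum>k<N. axis (\<omega> k) (1::real) $ i) = (\<Sum>k<N. \<Sum>i\<in>UNIV. axis (\<omega> k) 1 $ i)"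
    by (rule sum.swap)
  also have "\<dots> = real N" by (simp add: axis_def)
  finally show ?thesis using assms
    by (auto simp: prob_simplex_def empirical_def axis_def sum_nonneg simp flip: sum_divide_distrib)
qed

lemma empirical_event_measurable:
  fixes P :: "real ^ 's::finite"
  shows "{\<omega> \<in> space (iid_measure P). Q (empirical N \<omega>)} \<in> sets (iid_measure P)"
proof -
  have coord: "(\<lambda>\<omega>. \<omega> k) \<in> measurable (iid_measure P) (count_space UNIV)" for k
  proof -
    have "(\<lambda>\<omega>. \<omega> k) \<in> measurable (iid_measure P) (dist_measure P)"
      unfolding iid_measure_def by (rule measurable_component_singleton) simp
    moreover have "sets (dist_measure P) = sets (count_space UNIV)"
      by (simp add: dist_measure_def point_measure_def)
    ultimately show ?thesis
      using measurable_cong_sets[OF refl] by blast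
  qed
  have "(\<lambda>\<omega>. map \<omega> [0..<n]) \<in> measurable (iid_measure P) (count_space UNIV)" for n
  proof (induction n)
    case (Suc n)
    have "(\<lambda>\<omega>. (\<lambda>xs. xs @ [\<omega> n]) (map \<omega> [0..<n])) \<in> measurable (iid_measure P) (count_space UNIV)"
      by (rule measurable_compose_countable[OF _ Suc], rule measurable_compose[OF coord]) simp
    then show ?case by simp
  qed simp
  moreover have "empirical N \<omega> = (1 / real N) *\<^sub>R (\<Sum>s\<leftarrow>map \<omega> [0..<N]. axis s 1)" for \<omega> :: "nat \<Rightarrow> 's"
    by (simp add: empirical_def comp_def interv_sum_list_conv_sum_set_nat atLeast0LessThan)
  ultimately show ?thesis
    using measurable_sets[of "\<lambda>\<omega>. map \<omega> [0..<N]" "iid_measure P" "count_space UNIV"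
        "{xs. Q ((1 / real N) *\<^sub>R (\<Sum>s\<leftarrow>xs. axis s 1))}"]
    by (simp add: vimage_def Int_def conj_commute)
qed

lemma KL_DRO_nonempty:
  assumes "Phat \<in> prob_simplex" "0 \<le> r"
  shows "expected_cost l x Phat \<in>
    {expected_cost l x P |P. P \<in> prob_simplex \<and> D_KL Phat P \<le> ereal r}"
proof -
  have "Phat $ \<xi> * ln (Phat $ \<xi> / Phat $ \<xi>) = 0" for \<xi>
    by (cases "Phat $ \<xi> = 0") auto
  then have "D_KL Phat Phat = 0"
    unfolding D_KL_def absolutely_continuous_def zero_ereal_def
    by (simp only: order_refl if_True sum.neutral_const)
  with assms show ?thesis by auto
qed

lemma KL_DRO_bdd_above:
  fixes l :: "'x \<Rightarrow> 's::finite \<Rightarrow> real"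
  shows "bdd_above {expected_cost l x P |P. P \<in> prob_simplex \<and> D_KL Phat P \<le> ereal r}"
proof (rule bdd_aboveI[where M="\<Sum>\<xi>\<in>UNIV. \<bar>l x \<xi>\<bar>"], clarify)
  fix P :: "real ^ 's" assume P: "P \<in> prob_simplex"
  have "P $ \<xi> \<le> 1" "0 \<le> P $ \<xi>" for \<xi>
    using P member_le_sum[of \<xi> UNIV "\<lambda>i. P $ i"] by (auto simp: prob_simplex_def)
  then have "P $ \<xi> * l x \<xi> \<le> \<bar>l x \<xi>\<bar>" for \<xi>
    by (smt (verit) mult_left_le_one_le mult_left_mono)
  then show "expected_cost l x P \<le> (\<Sum>\<xi>\<in>UNIV. \<bar>l x \<xi>\<bar>)"
    unfolding expected_cost_eq_sum[OF P] by (rule sum_mono)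
qed

end

theory Submission
  imports Defs "HOL-Real_Asymp.Real_Asymp"
begin

text \<open>
  If \<open>chat x Phat\<close> were smaller than \<open>expected_cost l x P\<close> for some \<open>P\<close> with
  \<open>D_KL Phat P \<le> r\<close>, then moving \<open>P\<close> slightly towards \<open>Phat\<close> would make the divergence strictly
  smaller than \<open>r\<close> (by convexity) while keeping the inequality of costs. By upper semicontinuity
  the predictor fails on a whole neighbourhood of \<open>Phat\<close>, and the empirical distribution of
  samples from \<open>P\<close> visits this neighbourhood with exponential rate at most \<open>D_KL Phat P < r\<close>,
  contradicting feasibility. This lower bound of Sanov's theorem is obtained by changing the
  measure from \<open>P\<close> to \<open>Phat\<close>: on words whose empirical distribution is close to \<open>Phat\<close> the
  likelihood ratio is at least \<open>exp (- N (D_KL Phat P + \<epsilon>))\<close>, and under \<open>Phat\<close> these words have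
  probability tending to 1 by Hoeffding's inequality.
\<close>

section \<open>Word probabilities and change of measure\<close>

lemma space_dist_measure [simp]: "space (dist_measure P) = UNIV"
  by (simp add: dist_measure_def space_point_measure)

lemma sets_dist_measure [simp, measurable_cong]: "sets (dist_measure P) = sets (count_space UNIV)"
  by (simp add: dist_measure_def sets_point_measure)

lemma space_iid_measure [simp]: "space (iid_measure P) = UNIV"
  by (simp add: iid_measure_def space_PiM)

lemma measure_dist_measure_singleton:
  assumes "P \<in> prob_simplex"
  shows "measure (dist_measure P) {s} = P $ s"
  using assms by (simp add: dist_measure_def measure_point_measure_finite_if prob_simplex_def)

lemma Prob_mono:
  fixes P :: "real ^ 's::finite"
  assumes "P \<in> prob_simplex" "\<And>\<omega>. A (empirical N \<omega>) \<Longrightarrow> B (empirical N \<omega>)"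
  shows "Prob P (\<lambda>\<omega>. A (empirical N \<omega>)) \<le> Prob P (\<lambda>\<omega>. B (empirical N \<omega>))"
proof -
  interpret prob_space "iid_measure P" by (rule prob_space_iid_measure[OF assms(1)])
  show ?thesis unfolding Prob_def
    by (rule finite_measure_mono) (use assms(2) empirical_event_measurable[of P B N] in auto)
qed

text \<open>The event depends on the first \<open>N\<close> samples only, so it splits into finitely
  many disjoint cylinders, one per word, with product probabilities. Comparing two sampling laws
  thus becomes a comparison of finite sums.\<close>

lemma Prob_words:
  fixes P :: "real ^ 's::finite"
  assumes P: "P \<in> prob_simplex"
  shows "Prob P (\<lambda>\<omega>. R (empirical N \<omega>)) =
    (\<Sum>w | w \<in> PiE {..<N} (\<lambda>_. UNIV) \<and> R (empirical N w). \<Prod>k<N. P $ w k)"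
proof -
  interpret D: prob_space "dist_measure P" by (rule prob_space_dist_measure[OF P])
  interpret product_prob_space "\<lambda>_. dist_measure P" "UNIV :: nat set" by unfold_locales
  \<comment> \<open>Words are extensional functions on \<open>{..<N}\<close>: this makes
    \<open>W\<close> finite, and distinct words differ at some index below \<open>N\<close>, so
    their cylinders are disjoint.\<close>
  define W where "W = {w \<in> PiE {..<N} (\<lambda>_. UNIV :: 's set). R (empirical N w)}"
  define C where "C w = prod_emb UNIV (\<lambda>_. dist_measure P) {..<N} (PiE {..<N} (\<lambda>k. {w k}))"
    for w :: "nat \<Rightarrow> 's"
  have C_iff: "\<omega> \<in> C w \<longleftrightarrow> (\<forall>k<N. \<omega> k = w k)" for \<omega> w
    by (auto simp: C_def prod_emb_def PiE_iff)
  have fin: "finite W"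
    unfolding W_def by (rule finite_subset[OF _ finite_PiE[of "{..<N}" "\<lambda>_. UNIV :: 's set"]]) auto
  have emp: "empirical N \<omega> = (empirical N w :: real ^ 's)" if "\<forall>k<N. \<omega> k = w k" for \<omega> w
    using that by (simp add: empirical_def)
  have ev: "{\<omega> \<in> space (iid_measure P). R (empirical N \<omega>)} = (\<Union>w\<in>W. C w)"
  proof (intro equalityI subsetI)
    fix \<omega> assume "\<omega> \<in> {\<omega> \<in> space (iid_measure P). R (empirical N \<omega>)}"
    then have "R (empirical N (restrict \<omega> {..<N}))"
      using emp[of \<omega> "restrict \<omega> {..<N}"] by simp
    then show "\<omega> \<in> (\<Union>w\<in>W. C w)"
      by (intro UN_I[of "restrict \<omega> {..<N}"]) (auto simp: W_def C_iff)
  next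
    fix \<omega> assume "\<omega> \<in> (\<Union>w\<in>W. C w)"
    then obtain w where "R (empirical N w)" "\<forall>k<N. \<omega> k = w k" by (auto simp: W_def C_iff)
    then show "\<omega> \<in> {\<omega> \<in> space (iid_measure P). R (empirical N \<omega>)}"
      using emp[of \<omega> w] by simp
  qed
  have disj: "disjoint_family_on C W"
    unfolding disjoint_family_on_def
  proof (intro ballI impI)
    fix v w assume "v \<in> W" "w \<in> W" "v \<noteq> w"
    then have "\<exists>k<N. v k \<noteq> w k"
      unfolding W_def by (metis (no_types, lifting) PiE_ext lessThan_iff mem_Collect_eq)
    then show "C v \<inter> C w = {}" by (auto simp: C_iff)
  qed
  have "Prob P (\<lambda>\<omega>. R (empirical N \<omega>)) = (\<Sum>w\<in>W. measure (iid_measure P) (C w))"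
    unfolding Prob_def ev unfolding iid_measure_def
    by (rule finite_measure_finite_Union[OF fin _ disj])
       (auto simp: C_def intro!: sets_PiM_I_finite)
  also have "\<dots> = (\<Sum>w\<in>W. \<Prod>k<N. P $ w k)"
    unfolding C_def iid_measure_def
    by (intro sum.cong refl, subst measure_PiM_emb) (auto simp: measure_dist_measure_singleton[OF assms])
  finally show ?thesis by (simp add: W_def)
qed

text \<open>Serves to turn a log-likelihood ratio summed along a word into a linear functional of
  its empirical distribution.\<close>

lemma sum_empirical:
  fixes f :: "'s::finite \<Rightarrow> real"
  shows "real N * (\<Sum>s\<in>UNIV. empirical N w $ s * f s) = (\<Sum>k<N. f (w k))"
proof (cases "N = 0")
  case False
  have "(\<Sum>k<N. f (w k)) = (\<Sum>k<N. \<Sum>s\<in>UNIV. axis (w k) 1 $ s * f s)"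
    by (intro sum.cong refl) (simp add: axis_def if_distrib[of "\<lambda>x. x * _"] cong: if_cong)
  also have "\<dots> = (\<Sum>s\<in>UNIV. (\<Sum>k<N. axis (w k) 1 $ s) * f s)"
    by (subst sum.swap) (simp add: sum_distrib_right)
  also have "\<dots> = real N * (\<Sum>s\<in>UNIV. empirical N w $ s * f s)"
    using False by (simp add: empirical_def sum_distrib_left field_simps)
  finally show ?thesis by simp
qed simp

text \<open>On a word \<open>w\<close> without letters of \<open>Q\<close>-mass zero, the likelihood
  ratio of \<open>P\<close> to \<open>Q\<close> is the exponential of \<open>- real N\<close> times
  the functional bounded in \<open>R\<close>, taken at \<open>empirical N w\<close>; hence it is at
  least \<open>exp (- (real N * b))\<close>. Summing over words gives the claim.\<close>

lemma change_of_measure: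
  fixes P Q :: "real ^ 's::finite"
  assumes P: "P \<in> prob_simplex" and Q: "Q \<in> prob_simplex"
    and ac: "\<And>s. P $ s = 0 \<Longrightarrow> Q $ s = 0"
    and R: "\<And>q. R q \<Longrightarrow> (\<Sum>s\<in>UNIV. q $ s * ln (Q $ s / P $ s)) \<le> b"
  shows "exp (- (real N * b)) * Prob Q (\<lambda>\<omega>. R (empirical N \<omega>)) \<le> Prob P (\<lambda>\<omega>. R (empirical N \<omega>))"
proof -
  have nn: "0 \<le> P $ s" "0 \<le> Q $ s" for s using P Q by (auto simp: prob_simplex_def)
  have "exp (- (real N * b)) * (\<Prod>k<N. Q $ w k) \<le> (\<Prod>k<N. P $ w k)"
    if Rw: "R (empirical N w)" for w
  \<comment> \<open>A letter of \<open>Q\<close>-mass zero makes the left side vanish. Otherwise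
    \<open>ac\<close> makes the \<open>P\<close>-masses of all letters of \<open>w\<close> positive
    too, so the logarithms are genuine.\<close>
  proof (cases "\<exists>k<N. Q $ w k = 0")
    case True
    then have "(\<Prod>k<N. Q $ w k) = 0" by (intro prod_zero) auto
    moreover have "0 \<le> (\<Prod>k<N. P $ w k)" by (intro prod_nonneg nn)
    ultimately show ?thesis by (simp only: mult_zero_right)
  next
    case False
    have pos: "0 < Q $ w k" "0 < P $ w k" if "k < N" for k
      using that False ac nn[of "w k"] by (metis less_le)+
    have "(\<Sum>k<N. ln (Q $ w k / P $ w k)) \<le> real N * b"
      using R[OF Rw] by (subst sum_empirical[symmetric]) (simp add: mult_left_mono)
    then have "exp (- (real N * b)) * (\<Prod>k<N. Q $ w k)
        \<le> exp (- (\<Sum>k<N. ln (Q $ w k / P $ w k))) * (\<Prod>k<N. Q $ w k)"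
      by (intro mult_right_mono) (auto intro: prod_nonneg nn)
    also have "\<dots> = (\<Prod>k<N. exp (- ln (Q $ w k / P $ w k)) * Q $ w k)"
      by (simp add: exp_sum prod.distrib flip: sum_negf)
    also have "\<dots> = (\<Prod>k<N. P $ w k)"
    proof (intro prod.cong refl)
      fix k assume "k \<in> {..<N}"
      then have "0 < Q $ w k" "0 < P $ w k" using pos by auto
      then show "exp (- ln (Q $ w k / P $ w k)) * Q $ w k = P $ w k"
        by (simp add: exp_minus)
    qed
    finally show ?thesis .
  qed
  then show ?thesis
    unfolding Prob_words[OF P] Prob_words[OF Q] sum_distrib_left by (intro sum_mono) auto
qed

section \<open>Concentration of the empirical distribution\<close>

lemma indep_vars_coordinates:
  fixes P :: "real ^ 's::finite"
  assumes P: "P \<in> prob_simplex"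
  shows "prob_space.indep_vars (iid_measure P) (\<lambda>_. dist_measure P) (\<lambda>k \<omega>. \<omega> k) UNIV"
proof -
  interpret prob_space "iid_measure P" by (rule prob_space_iid_measure[OF P])
  have [simp]: "distr (iid_measure P) (dist_measure P) (\<lambda>\<omega>. \<omega> k) = dist_measure P" for k
    unfolding iid_measure_def by (rule distr_PiM_component) (auto intro: prob_space_dist_measure[OF P])
  have "random_variable (dist_measure P) (\<lambda>\<omega>. \<omega> k)" for k
    unfolding iid_measure_def by measurable
  moreover have "distr (iid_measure P) (Pi\<^sub>M UNIV (\<lambda>_. dist_measure P)) (\<lambda>\<omega>. \<lambda>k\<in>UNIV. \<omega> k)
      = Pi\<^sub>M UNIV (\<lambda>k. distr (iid_measure P) (dist_measure P) (\<lambda>\<omega>. \<omega> k))"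
    using distr_id[of "iid_measure P"] by (simp add: restrict_UNIV iid_measure_def[of P, symmetric])
  ultimately show ?thesis
    by (subst indep_vars_iff_distr_eq_PiM) auto
qed

text \<open>Hoeffding's inequality for the indicators of the letter \<open>s\<close>: they are
  i.i.d. with values in \<open>[0, 1]\<close> and mean \<open>P $ s\<close>, and their average is
  the coordinate \<open>s\<close> of the empirical distribution.\<close>

lemma Prob_coordinate_deviation:
  fixes P :: "real ^ 's::finite"
  assumes P: "P \<in> prob_simplex" and "0 < \<delta>" "0 < N"
  shows "Prob P (\<lambda>\<omega>. \<delta> \<le> \<bar>empirical N \<omega> $ s - P $ s\<bar>) \<le> 2 * exp (-2 * real N * \<delta>\<^sup>2)"
proof -
  interpret prob_space "iid_measure P" by (rule prob_space_iid_measure[OF P])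
  define X where "X k \<omega> = (indicator {s} (\<omega> k) :: real)" for k :: nat and \<omega> :: "nat \<Rightarrow> 's"
  have coord [measurable]: "(\<lambda>\<omega>. \<omega> k) \<in> measurable (iid_measure P) (dist_measure P)" for k
    unfolding iid_measure_def by measurable
  have ind [measurable]: "(indicator {s} :: 's \<Rightarrow> real) \<in> borel_measurable (dist_measure P)"
    by measurable
  have D: "distr (iid_measure P) (dist_measure P) (\<lambda>\<omega>. \<omega> k) = dist_measure P" for k
    unfolding iid_measure_def by (rule distr_PiM_component) (auto intro: prob_space_dist_measure[OF P])
  \<comment> \<open>The common law required by the i.i.d. form of Hoeffding's inequality:
    \<open>X k\<close> factors through the coordinate \<open>k\<close>, whose law is
    \<open>dist_measure P\<close> for every \<open>k\<close>.\<close>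
  have DX: "distr (iid_measure P) borel (X k) = distr (dist_measure P) borel (indicator {s})" for k
  proof -
    have "distr (distr (iid_measure P) (dist_measure P) (\<lambda>\<omega>. \<omega> k)) borel (indicator {s})
        = distr (iid_measure P) borel (X k)"
      by (subst distr_distr) (auto simp: comp_def X_def[abs_def])
    then show ?thesis by (simp add: D)
  qed
  have indep: "indep_vars (\<lambda>_. borel) X {..<N}"
    unfolding X_def
    by (rule indep_vars_subset[OF indep_vars_compose2[OF indep_vars_coordinates[OF P]]]) auto
  interpret Hoeffding_ineq_iid "iid_measure P" "{..<N}" X "X 0" 0 1 "expectation (X 0)"
    by unfold_locales (use indep DX in \<open>auto simp: X_def[abs_def] indicator_def\<close>)
  have "expectation (X 0) = (\<integral>x. indicator {s} x \<partial>distr (iid_measure P) (dist_measure P) (\<lambda>\<omega>. \<omega> 0))"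
    by (subst integral_distr) (auto simp: X_def[abs_def])
  then have EX: "expectation (X 0) = P $ s"
    by (simp add: D measure_dist_measure_singleton[OF P])
  have "X k \<omega> = axis (\<omega> k) 1 $ s" for k \<omega>
    by (auto simp: X_def axis_def)
  then have "(\<Sum>k<N. X k \<omega>) / real N = empirical N \<omega> $ s" for \<omega>
    by (simp add: empirical_def)
  moreover have "{..<N} \<noteq> {}" using \<open>0 < N\<close> by blast
  ultimately show ?thesis
    using Hoeffding_ineq_abs_ge'[of \<delta>] \<open>0 < \<delta>\<close>
    by (simp add: EX Prob_def)
qed

text \<open>A union bound over the finitely many letters. The level \<open>1/2\<close> is an
  arbitrary constant below 1; constant factors are invisible on the exponential scale.\<close>

lemma empirical_concentration:
  fixes P :: "real ^ 's::finite"
  assumes P: "P \<in> prob_simplex" and "0 < \<delta>"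
  shows "\<forall>\<^sub>F N in sequentially. 1/2 \<le> Prob P (\<lambda>\<omega>. \<forall>s. \<bar>empirical N \<omega> $ s - P $ s\<bar> < \<delta>)"
proof -
  interpret prob_space "iid_measure P" by (rule prob_space_iid_measure[OF P])
  define A where "A N s = {\<omega> \<in> space (iid_measure P). \<delta> \<le> \<bar>empirical N \<omega> $ s - P $ s\<bar>}" for N s
  have A: "A N s \<in> sets (iid_measure P)" for N s
    unfolding A_def by (rule empirical_event_measurable)
  have "((\<lambda>N. real CARD('s) * (2 * exp (-2 * real N * \<delta>\<^sup>2))) \<longlongrightarrow> 0) sequentially"
    using \<open>0 < \<delta>\<close> by real_asymp
  then have "\<forall>\<^sub>F N in sequentially. real CARD('s) * (2 * exp (-2 * real N * \<delta>\<^sup>2)) < 1/2"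
    by (rule order_tendstoD) simp
  with eventually_gt_at_top[of 0] show ?thesis
  proof eventually_elim
    case (elim N)
    have "prob (\<Union>s. A N s) \<le> (\<Sum>s\<in>UNIV. prob (A N s))"
      by (rule finite_measure_subadditive_finite) (use A in auto)
    also have "\<dots> \<le> (\<Sum>s\<in>(UNIV :: 's set). 2 * exp (-2 * real N * \<delta>\<^sup>2))"
      using Prob_coordinate_deviation[OF P \<open>0 < \<delta>\<close> elim(1)]
      by (intro sum_mono) (simp add: A_def Prob_def)
    also have "\<dots> < 1/2" using elim(2) by simp
    finally have "1/2 \<le> prob (space (iid_measure P) - (\<Union>s. A N s))"
      using A by (subst prob_compl) auto
    also have "space (iid_measure P) - (\<Union>s. A N s)
        = {\<omega> \<in> space (iid_measure P). \<forall>s. \<bar>empirical N \<omega> $ s - P $ s\<bar> < \<delta>}"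
      by (simp add: A_def set_eq_iff not_le)
    finally show ?case by (simp add: Prob_def)
  qed
qed

section \<open>Lower bounds on the exponential scale\<close>

text \<open>Sanov's lower bound for an event holding near \<open>Q\<close>. The strict inequality
  leaves room for two losses: the variation of the likelihood ratio near \<open>Q\<close>, and the
  factor \<open>1/2\<close> from concentration.\<close>

lemma large_deviation_lower_bound:
  fixes P Q :: "real ^ 's::finite"
  assumes P: "P \<in> prob_simplex" and Q: "Q \<in> prob_simplex"
    and ac: "\<And>s. P $ s = 0 \<Longrightarrow> Q $ s = 0"
    and D: "(\<Sum>s\<in>UNIV. Q $ s * ln (Q $ s / P $ s)) < a"
    and E: "\<forall>\<^sub>F q in at Q within prob_simplex. E q" "E Q"
  shows "\<forall>\<^sub>F N in sequentially. exp (- (real N * a)) \<le> Prob P (\<lambda>\<omega>. E (empirical N \<omega>))"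
proof -
  define L where "L s = ln (Q $ s / P $ s)" for s
  define d where "d = (\<Sum>s\<in>UNIV. Q $ s * L s)"
  define K where "K = (\<Sum>s\<in>UNIV. \<bar>L s\<bar>)"
  \<comment> \<open>The midpoint splits this room: \<open>b - d\<close> covers the first loss,
    \<open>a - b\<close> the second.\<close>
  define b where "b = (d + a) / 2"
  have "d < b" "b < a" using D by (auto simp: b_def d_def L_def)
  have "0 \<le> K" by (simp add: K_def sum_nonneg)
  obtain \<eta> where "0 < \<eta>" and \<eta>: "\<And>q. q \<in> prob_simplex \<Longrightarrow> dist q Q < \<eta> \<Longrightarrow> E q"
    using E unfolding eventually_at by metis
  \<comment> \<open>The first bound puts the box of half-width \<delta> around \<open>Q\<close>
    inside the \<eta>-ball, via the l1 norm; the second keeps the functional with coefficients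
    \<open>L\<close> at most \<open>b - d\<close> above \<open>d\<close>. Using \<open>K + 1\<close>
    avoids a division by zero when \<open>K = 0\<close>.\<close>
  define \<delta> where "\<delta> = min (\<eta> / real CARD('s)) ((b - d) / (K + 1))"
  have "0 < \<delta>" using \<open>0 < \<eta>\<close> \<open>0 \<le> K\<close> \<open>d < b\<close> by (simp add: \<delta>_def)
  define G where "G q \<longleftrightarrow> (\<forall>s. \<bar>q $ s - Q $ s\<bar> < \<delta>)" for q
  have G_E: "E q" if "q \<in> prob_simplex" "G q" for q
  proof (rule \<eta>[OF that(1)])
    have "dist q Q \<le> (\<Sum>s\<in>UNIV. \<bar>(q - Q) $ s\<bar>)"
      unfolding dist_norm by (rule norm_le_l1_cart)
    also have "\<dots> < (\<Sum>s\<in>(UNIV :: 's set). \<delta>)"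
      using that(2) by (intro sum_strict_mono) (auto simp: G_def)
    also have "\<dots> \<le> \<eta>"
    proof -
      have "\<delta> \<le> \<eta> / real CARD('s)" by (simp add: \<delta>_def)
      then show ?thesis by (simp add: field_simps)
    qed
    finally show "dist q Q < \<eta>" .
  qed
  have G_b: "(\<Sum>s\<in>UNIV. q $ s * ln (Q $ s / P $ s)) \<le> b" if "G q" for q
  proof -
    have "(\<Sum>s\<in>UNIV. q $ s * L s) - d = (\<Sum>s\<in>UNIV. (q $ s - Q $ s) * L s)"
      by (simp add: d_def sum_subtractf left_diff_distrib)
    also have "\<dots> \<le> (\<Sum>s\<in>UNIV. \<delta> * \<bar>L s\<bar>)"
    proof (rule sum_mono)
      fix s
      have "(q $ s - Q $ s) * L s \<le> \<bar>q $ s - Q $ s\<bar> * \<bar>L s\<bar>"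
        by (metis abs_ge_self abs_mult)
      also have "\<dots> \<le> \<delta> * \<bar>L s\<bar>"
        using that by (intro mult_right_mono) (auto simp: G_def less_imp_le)
      finally show "(q $ s - Q $ s) * L s \<le> \<delta> * \<bar>L s\<bar>" .
    qed
    also have "\<dots> = \<delta> * K" by (simp add: K_def sum_distrib_left)
    also have "\<dots> \<le> (b - d) / (K + 1) * (K + 1)"
      using \<open>0 \<le> K\<close> \<open>d < b\<close> by (intro mult_mono) (auto simp: \<delta>_def)
    also have "\<dots> = b - d" using \<open>0 \<le> K\<close> by simp
    finally show ?thesis by (simp add: L_def)
  qed
  define c where "c = a - b"
  have "0 < c" using \<open>b < a\<close> by (simp add: c_def)
  then have "\<forall>\<^sub>F N in sequentially. exp (- (real N * c)) \<le> 1/2"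
    by real_asymp
  then have "\<forall>\<^sub>F N in sequentially. exp (- (real N * a)) \<le> exp (- (real N * b)) * (1/2)"
  proof eventually_elim
    case (elim N)
    have "exp (- (real N * a)) = exp (- (real N * b)) * exp (- (real N * c))"
      by (simp add: c_def algebra_simps flip: exp_add)
    with elim show ?case by simp
  qed
  then show ?thesis
    using empirical_concentration[OF Q \<open>0 < \<delta>\<close>] eventually_gt_at_top[of 0]
  proof eventually_elim
    case (elim N)
    note elim(1)
    also have "exp (- (real N * b)) * (1/2)
        \<le> exp (- (real N * b)) * Prob Q (\<lambda>\<omega>. G (empirical N \<omega>))"
      using elim(2) unfolding G_def by (intro mult_left_mono) auto
    also have "\<dots> \<le> Prob P (\<lambda>\<omega>. G (empirical N \<omega>))"
      by (rule change_of_measure[OF P Q ac G_b])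
    also have "\<dots> \<le> Prob P (\<lambda>\<omega>. E (empirical N \<omega>))"
      by (rule Prob_mono[OF P]) (use G_E empirical_in_prob_simplex[OF elim(3)] in blast)
    finally show ?case .
  qed
qed

text \<open>The exponential bound makes \<open>p N\<close> positive, so \<open>elog\<close> is a
  true logarithm there, and dividing by \<open>N > 0\<close> gives the rate.\<close>

lemma le_limsup_elog:
  assumes "\<forall>\<^sub>F N in sequentially. exp (- (real N * a)) \<le> p N"
  shows "ereal (- a) \<le> limsup (\<lambda>N. ereal (1 / real N) * elog (p N))"
proof (rule le_Limsup)
  show "\<forall>\<^sub>F N in sequentially. ereal (- a) \<le> ereal (1 / real N) * elog (p N)"
    using assms eventually_gt_at_top[of 0]
  proof eventually_elim
    case (elim N)
    then have "0 < p N" using less_le_trans[OF exp_gt_zero] by blast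
    moreover from this have "- (real N * a) \<le> ln (p N)"
      using elim(1) by (simp add: ln_ge_iff)
    ultimately show ?case using elim(2) by (simp add: elog_def field_simps)
  qed
qed simp

section \<open>Finite divergence and convexity of relative entropy\<close>

text \<open>A finite bound excludes the infinite branch of \<open>D_KL\<close>; absolute continuity
  is then tested on singletons.\<close>

lemma D_KL_le_ereal:
  fixes P Q :: "real ^ 's::finite"
  assumes "P \<in> prob_simplex" "Q \<in> prob_simplex" "D_KL Q P \<le> ereal r"
  shows "P $ s = 0 \<Longrightarrow> Q $ s = 0" "(\<Sum>s\<in>UNIV. Q $ s * ln (Q $ s / P $ s)) \<le> r"
proof -
  have ac: "absolutely_continuous (dist_measure P) (dist_measure Q)"
    using assms(3) by (auto simp: D_KL_def split: if_splits)
  then show "(\<Sum>s\<in>UNIV. Q $ s * ln (Q $ s / P $ s)) \<le> r"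
    using assms(3) by (simp add: D_KL_def)
  assume "P $ s = 0"
  then have "{s} \<in> null_sets (dist_measure P)"
    by (simp add: dist_measure_def null_sets_point_measure_iff)
  then have "{s} \<in> null_sets (dist_measure Q)"
    using ac by (auto simp: absolutely_continuous_def)
  then have "Q $ s \<le> 0"
    by (simp add: dist_measure_def null_sets_point_measure_iff ennreal_eq_0_iff)
  then show "Q $ s = 0"
    using assms(2) by (simp add: prob_simplex_def order.antisym)
qed

lemma prob_simplex_segment:
  assumes "P \<in> prob_simplex" "Q \<in> prob_simplex" "0 \<le> t" "t \<le> (1::real)"
  shows "(1 - t) *\<^sub>R P + t *\<^sub>R Q \<in> prob_simplex"
  using assms by (auto simp: prob_simplex_def sum.distrib simp flip: sum_distrib_left)

text \<open>Convexity of the divergence in its second argument, where the endpoint \<open>Q\<close>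
  contributes zero; termwise it is concavity of \<open>ln\<close>.\<close>

lemma relative_entropy_segment_le:
  fixes P Q :: "real ^ 's::finite"
  assumes P: "P \<in> prob_simplex" and Q: "Q \<in> prob_simplex"
    and ac: "\<And>s. P $ s = 0 \<Longrightarrow> Q $ s = 0"
    and t: "0 \<le> t" "t \<le> 1"
  shows "(\<Sum>s\<in>UNIV. Q $ s * ln (Q $ s / ((1 - t) *\<^sub>R P + t *\<^sub>R Q) $ s))
    \<le> (1 - t) * (\<Sum>s\<in>UNIV. Q $ s * ln (Q $ s / P $ s))"
  unfolding sum_distrib_left
proof (rule sum_mono)
  fix s
  show "Q $ s * ln (Q $ s / ((1 - t) *\<^sub>R P + t *\<^sub>R Q) $ s) \<le> (1 - t) * (Q $ s * ln (Q $ s / P $ s))"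
  proof (cases "Q $ s = 0")
    case False
    then have pos: "0 < Q $ s" "0 < P $ s"
      using ac[of s] P Q by (auto simp: prob_simplex_def less_le)
    \<comment> \<open>The library rule bounds convex combinations from above, hence the negated
      arguments.\<close>
    have m: "0 < (1 - t) * P $ s + t * Q $ s"
      using convex_bound_lt[of "- P $ s" 0 "- Q $ s" "1 - t" t] pos t by simp
    have "(1 - t) * ln (P $ s) + t * ln (Q $ s) \<le> ln ((1 - t) * P $ s + t * Q $ s)"
      using ln_concave pos t unfolding concave_on_iff by simp
    then have "ln (Q $ s / ((1 - t) * P $ s + t * Q $ s)) \<le> (1 - t) * ln (Q $ s / P $ s)"
      using pos m by (simp add: ln_div algebra_simps)
    then have "Q $ s * ln (Q $ s / ((1 - t) * P $ s + t * Q $ s))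
        \<le> Q $ s * ((1 - t) * ln (Q $ s / P $ s))"
      using pos by (intro mult_left_mono) auto
    then show ?thesis by (simp add: mult_ac)
  qed simp
qed

section \<open>Feasibility and the bound on the expected cost\<close>

lemma pointwise_feasibleD:
  assumes "pointwise_feasible X l r chat" "P \<in> prob_simplex" "x \<in> X"
  shows "limsup (\<lambda>N. ereal (1 / real N) *
    elog (Prob P (\<lambda>\<omega>. expected_cost l x P > chat x (empirical N \<omega>)))) \<le> ereal (- r)"
  using assms unfolding pointwise_feasible_def SUP_le_iff by force

lemma elog_mono: "0 \<le> p \<Longrightarrow> p \<le> q \<Longrightarrow> elog p \<le> elog q"
  by (auto simp: elog_def)

text \<open>For fixed \<open>x\<close> in \<open>X\<close> the failure event is contained in the
  uniform one, so only pointwise feasibility has to be treated afterwards.\<close>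

lemma uniformly_feasible_imp_pointwise_feasible:
  fixes l :: "'x \<Rightarrow> 's::finite \<Rightarrow> real"
  assumes "uniformly_feasible X l r chat"
  shows "pointwise_feasible X l r chat"
  unfolding pointwise_feasible_def
proof (rule SUP_least, clarify)
  fix P :: "real ^ 's" and x assume P: "P \<in> prob_simplex" and x: "x \<in> X"
  have "limsup (\<lambda>N. ereal (1 / real N) *
      elog (Prob P (\<lambda>\<omega>. expected_cost l x P > chat x (empirical N \<omega>))))
    \<le> limsup (\<lambda>N. ereal (1 / real N) *
      elog (Prob P (\<lambda>\<omega>. \<exists>x\<in>X. expected_cost l x P > chat x (empirical N \<omega>))))"
    by (intro Limsup_mono always_eventually allI ereal_mult_left_mono elog_mono
        Prob_mono[OF P, where A = "\<lambda>q. expected_cost l x P > chat x q"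
          and B = "\<lambda>q. \<exists>x\<in>X. expected_cost l x P > chat x q"])
       (use x in \<open>auto simp: Prob_def\<close>)
  also have "\<dots> \<le> ereal (- r)"
    using assms P unfolding uniformly_feasible_def SUP_le_iff by blast
  finally show "limsup (\<lambda>N. ereal (1 / real N) *
      elog (Prob P (\<lambda>\<omega>. expected_cost l x P > chat x (empirical N \<omega>)))) \<le> ereal (- r)" .
qed

lemma expected_cost_le_of_relative_entropy_less:
  fixes P Q :: "real ^ 's::finite"
  assumes feas: "pointwise_feasible X l r chat" and usc: "usc_on prob_simplex (chat x)"
    and x: "x \<in> X" and P: "P \<in> prob_simplex" and Q: "Q \<in> prob_simplex"
    and ac: "\<And>s. P $ s = 0 \<Longrightarrow> Q $ s = 0"
    and D: "(\<Sum>s\<in>UNIV. Q $ s * ln (Q $ s / P $ s)) < r"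
  shows "expected_cost l x P \<le> chat x Q"
proof (rule ccontr)
  assume "\<not> ?thesis"
  then have less: "chat x Q < expected_cost l x P" by simp
  \<comment> \<open>The rate found below is at least \<open>- a\<close>, so \<open>a < r\<close> is
    what contradicts feasibility.\<close>
  obtain a where a: "(\<Sum>s\<in>UNIV. Q $ s * ln (Q $ s / P $ s)) < a" "a < r"
    using dense[OF D] by blast
  have "\<forall>\<^sub>F q in at Q within prob_simplex. expected_cost l x P > chat x q"
    using usc Q less unfolding usc_on_def by blast
  from le_limsup_elog[OF large_deviation_lower_bound[OF P Q ac a(1) this less]]
  have "ereal (- a) \<le> ereal (- r)"
    using pointwise_feasibleD[OF feas P x] by (rule order_trans)
  with a(2) show False by simp
qed

text \<open>The boundary case of divergence exactly \<open>r\<close> is reached as a limit: mixing a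
  little of \<open>Q\<close> into \<open>P\<close> makes the divergence strictly smaller than
  \<open>r\<close>.\<close>

lemma expected_cost_le_of_D_KL_le:
  fixes P Q :: "real ^ 's::finite"
  assumes feas: "pointwise_feasible X l r chat" and usc: "usc_on prob_simplex (chat x)"
    and x: "x \<in> X" and P: "P \<in> prob_simplex" and Q: "Q \<in> prob_simplex"
    and r: "0 < r" and D: "D_KL Q P \<le> ereal r"
  shows "expected_cost l x P \<le> chat x Q"
proof -
  note ac = D_KL_le_ereal(1)[OF P Q D] and D_le = D_KL_le_ereal(2)[OF P Q D]
  define M where "M t = (1 - t) *\<^sub>R P + t *\<^sub>R Q" for t
  have "expected_cost l x (M t) \<le> chat x Q" if t: "0 < t" "t < 1" for t
  proof (rule expected_cost_le_of_relative_entropy_less[OF feas usc x _ Q])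
    show "M t \<in> prob_simplex"
      unfolding M_def using t by (intro prob_simplex_segment P Q) auto
    show "Q $ s = 0" if "M t $ s = 0" for s
    proof -
      have "0 \<le> (1 - t) * P $ s" "0 \<le> t * Q $ s"
        using t P Q by (auto simp: prob_simplex_def)
      with that t show ?thesis by (simp add: M_def add_nonneg_eq_0_iff)
    qed
    have "(\<Sum>s\<in>UNIV. Q $ s * ln (Q $ s / M t $ s)) \<le> (1 - t) * (\<Sum>s\<in>UNIV. Q $ s * ln (Q $ s / P $ s))"
      unfolding M_def using t by (intro relative_entropy_segment_le P Q ac) auto
    also have "\<dots> \<le> (1 - t) * r" using t D_le by (intro mult_left_mono) auto
    \<comment> \<open>Strict because \<open>t\<close> and \<open>r\<close> are positive, even if the
      divergence at \<open>P\<close> equals \<open>r\<close>.\<close>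
    also have "\<dots> < r" using t r by simp
    finally show "(\<Sum>s\<in>UNIV. Q $ s * ln (Q $ s / M t $ s)) < r" .
  qed
  moreover have "\<forall>\<^sub>F t in at_right 0. 0 < t \<and> t < (1::real)"
    by (auto simp: eventually_at_right_field intro: exI[of _ 1])
  ultimately have "\<forall>\<^sub>F t in at_right 0. expected_cost l x (M t) \<le> chat x Q"
    by (auto elim: eventually_mono)
  \<comment> \<open>The sum formula for the cost requires \<open>M t\<close> in the simplex, hence
    \<open>t\<close> in the unit interval; the sum is affine in \<open>t\<close>, so it tends to its
    value at \<open>M 0 = P\<close>.\<close>
  then have "\<forall>\<^sub>F t in at_right 0. (\<Sum>s\<in>UNIV. M t $ s * l x s) \<le> chat x Q"
    using \<open>\<forall>\<^sub>F t in at_right 0. 0 < t \<and> t < (1::real)\<close>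
    by eventually_elim
       (simp add: M_def expected_cost_eq_sum[OF prob_simplex_segment[OF P Q]])
  moreover have "((\<lambda>t. \<Sum>s\<in>UNIV. M t $ s * l x s) \<longlongrightarrow> (\<Sum>s\<in>UNIV. M 0 $ s * l x s)) (at_right 0)"
    unfolding M_def by (auto intro!: tendsto_eq_intros)
  ultimately have "(\<Sum>s\<in>UNIV. M 0 $ s * l x s) \<le> chat x Q"
    by (intro tendsto_upperbound) auto
  then show ?thesis by (simp add: M_def expected_cost_eq_sum[OF P])
qed

theorem theorem4p2:
  fixes X :: "(real ^ 'm) set"
    and l :: "real ^ 'm \<Rightarrow> 's::finite \<Rightarrow> real"
    and r :: real
    and chat :: "(real ^ 'm, 's) predictor"
  assumes "CARD('s) \<ge> 2"
    and "X \<noteq> {}"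
    and "loss_bounded_below X l"
    and "r > 0"
    and "chat \<in> usc_predictors X"
    and "pointwise_feasible X l r chat \<or> uniformly_feasible X l r chat"
  shows "\<forall>x\<in>X. \<forall>Phat\<in>prob_simplex. KL_DRO l r x Phat \<le> chat x Phat"
proof (intro ballI)
  fix x and Phat :: "real ^ 's" assume x: "x \<in> X" and Phat: "Phat \<in> prob_simplex"
  have feas: "pointwise_feasible X l r chat"
    using assms(6) uniformly_feasible_imp_pointwise_feasible by blast
  have usc: "usc_on prob_simplex (chat x)"
    using assms(5) x by (simp add: usc_predictors_def)
  show "KL_DRO l r x Phat \<le> chat x Phat"
    unfolding KL_DRO_def
  proof (rule cSup_least)
    \<comment> \<open>A real \<open>Sup\<close> obeys an upper bound only for a nonempty set;
      \<open>Phat\<close> itself is admissible, having divergence zero from itself.\<close>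
    show "{expected_cost l x P |P. P \<in> prob_simplex \<and> D_KL Phat P \<le> ereal r} \<noteq> {}"
      using KL_DRO_nonempty[OF Phat, of r l x] assms(4) by auto
  qed (use expected_cost_le_of_D_KL_le[OF feas usc x _ Phat assms(4)] in auto)
qed

end
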